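(* Suppose the null model $\mathcal{M}_0=\{p_{\mu_0}\}$ is a singleton ($m_0=0$), so that $p_{B,0}=p_{\mu_0}$, and let $r_{\mathrm{sw}}(x^n)=p_{B,0}(x^n)/p_{\mathrm{sw},1}(x^n)$. Then model comparison by switching with threshold $t(\alpha)=\alpha$ (select $\mathcal{M}_1$ if and only if $r_{\mathrm{sw}}(x^n)\le\alpha$) defines a robust null hypothesis test for $\mathcal{M}_0$: for all $0\le\alpha\le1$, $$\mathbb{P}_{\mu_0}\left(\exists n:\ r_{\mathrm{sw}}(X^n)\le\alpha\right)\le\alpha.$$
   Context: Observations $X_1,X_2,\ldots$ take values in $\mathcal X\subset\mathbb{R}^d$. $\mathcal{M}_1=\{p_\mu:\mu\in M_1\}$ is an $m_1$-dimensional exponential family ($m_1>0$) of densities on $\mathcal X$ relative to a fixed underlying measure, with common support $\mathcal X$, given in its mean-value parameterization (densities $e^{\theta^T\phi(x)-\psi(\theta)}r(x)$, $\theta$ in an open connected set, minimal representation, $\mu=\mathbb{E}_\theta[\phi(X)]$), with $M_1\subset\mathbb{R}^{m_1}$ a product of open (possibly unbounded) intervals; $\mu_0\in M_1$ is a fixed point and $\mathcal{M}_0=\{p_{\mu_0}\}$. $p_\mu(x^n)=\prod_{i=1}^np_\mu(x_i)$, and $\mathbb{P}_{\mu_0}$ is the distribution under which $X_1,X_2,\ldots$ are i.i.d. with density $p_{\mu_0}$. $\omega_1$ is a continuous, strictly positive (proper) prior density on $M_1$, $p_{B,1}(x^n)=\int_{M_1}\omega_1(\mu)p_\mu(x^n)\,d\mu$,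 and $p_{B,1}(x_t,\ldots,x_n\mid x^{t-1})=p_{B,1}(x^n)/p_{B,1}(x^{t-1})$. For $t\ge1$, $\bar p_t(x^n)=p_{B,0}(x^{t-1})\,p_{B,1}(x_t,\ldots,x_n\mid x^{t-1})$ if $t\le n$ and $\bar p_t(x^n)=p_{B,0}(x^n)$ if $t>n$. The switch distribution is $p_{\mathrm{sw},1}(x^n)=\sum_{t=1}^\infty\pi(t)\bar p_t(x^n)$, where $\pi$ is a probability mass function with support $\{2^0,2^1,2^2,\ldots\}$ and $\pi(2^i)$ decaying like $i^{-\kappa}$ for some $\kappa>1$. A model comparison method $r$ (a function from samples of arbitrary size to the nonnegative reals) with threshold $t$ has associated model selection rule $\delta_{r,t}(x^n)=1$ if $r(x^n)\le t$ and $0$ otherwise. It defines a robust null hypothesis test for $\mathcal{M}_0$ (with threshold function $t(\alpha)$) if $\mathbb{P}_{\mu_0}(\exists n:\delta_{r,t(\alpha)}(X^n)=1)\le\alpha$ for all $\mu_0\in M_0$ and all $0\le\alpha\le1$. *)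

theory Defs
  imports "HOL-Probability.Probability" "HOL-Library.Landau_Symbols"
begin

section \<open>Exponential families in the mean-value parameterization\<close>

text \<open>
  The dimensions \<open>d\<close> and \<open>m\<^sub>1\<close> are \<open>CARD('d)\<close> and \<open>CARD('m)\<close>. The sample space
  \<open>\<X> \<subseteq> \<real>\<^sup>d\<close> is the space of the underlying measure \<open>\<nu>\<close>; \<open>h\<close> is the carrier density
  (the factor \<open>r(x)\<close> in \<open>exp (\<theta>\<^sup>T \<phi>(x) - \<psi>(\<theta>)) r(x)\<close>) and \<open>\<Gamma>\<close> is the set over which
  the natural parameter \<open>\<theta>\<close> ranges.
\<close>

definition log_partition ::
    "(real^'d) measure \<Rightarrow> (real^'d \<Rightarrow> real^'m) \<Rightarrow> (real^'d \<Rightarrow> real) \<Rightarrow> real^'m \<Rightarrow> real" where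
  "log_partition \<nu> \<phi> h \<theta> = ln (\<integral>x. exp (\<theta> \<bullet> \<phi> x) * h x \<partial>\<nu>)"

definition natural_density ::
    "(real^'d) measure \<Rightarrow> (real^'d \<Rightarrow> real^'m) \<Rightarrow> (real^'d \<Rightarrow> real) \<Rightarrow> real^'m \<Rightarrow> real^'d \<Rightarrow> real" where
  "natural_density \<nu> \<phi> h \<theta> x = exp (\<theta> \<bullet> \<phi> x - log_partition \<nu> \<phi> h \<theta>) * h x"

definition mean_value ::
    "(real^'d) measure \<Rightarrow> (real^'d \<Rightarrow> real^'m) \<Rightarrow> (real^'d \<Rightarrow> real) \<Rightarrow> real^'m \<Rightarrow> real^'m" where
  "mean_value \<nu> \<phi> h \<theta> = (\<integral>x. natural_density \<nu> \<phi> h \<theta> x *\<^sub>R \<phi> x \<partial>\<nu>)"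

definition minimal_representation ::
    "(real^'d) measure \<Rightarrow> (real^'d \<Rightarrow> real^'m) \<Rightarrow> bool" where
  "minimal_representation \<nu> \<phi> \<longleftrightarrow> (\<forall>a c. (AE x in \<nu>. a \<bullet> \<phi> x = c) \<longrightarrow> a = 0)"

text \<open>
  Positivity of \<open>h\<close> on \<open>\<X>\<close> says that all densities of the family have support \<open>\<X>\<close>.
\<close>

definition exponential_family ::
    "(real^'d) set \<Rightarrow> (real^'d) measure \<Rightarrow> (real^'d \<Rightarrow> real^'m) \<Rightarrow> (real^'d \<Rightarrow> real)
      \<Rightarrow> (real^'m) set \<Rightarrow> bool" where
  "exponential_family \<X> \<nu> \<phi> h \<Gamma> \<longleftrightarrow>
     sets \<nu> = sets (restrict_space borel \<X>) \<and>
     \<phi> \<in> borel_measurable \<nu> \<and>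
     h \<in> borel_measurable \<nu> \<and> (\<forall>x\<in>\<X>. 0 < h x) \<and>
     open \<Gamma> \<and> connected \<Gamma> \<and>
     (\<forall>\<theta>\<in>\<Gamma>. integrable \<nu> (\<lambda>x. exp (\<theta> \<bullet> \<phi> x) * h x)) \<and>
     minimal_representation \<nu> \<phi>"

definition mean_space ::
    "(real^'d) measure \<Rightarrow> (real^'d \<Rightarrow> real^'m) \<Rightarrow> (real^'d \<Rightarrow> real) \<Rightarrow> (real^'m) set \<Rightarrow> (real^'m) set" where
  "mean_space \<nu> \<phi> h \<Gamma> = mean_value \<nu> \<phi> h ` \<Gamma>"

text \<open>
  For a minimal representation \<open>mean_value\<close> is injective on \<open>\<Gamma>\<close>, so \<open>inv_into\<close> involves
  no choice for \<open>\<mu>\<close> in the mean-value parameter space.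
\<close>

definition mean_density ::
    "(real^'d) measure \<Rightarrow> (real^'d \<Rightarrow> real^'m) \<Rightarrow> (real^'d \<Rightarrow> real) \<Rightarrow> (real^'m) set
      \<Rightarrow> real^'m \<Rightarrow> real^'d \<Rightarrow> real" where
  "mean_density \<nu> \<phi> h \<Gamma> \<mu> = natural_density \<nu> \<phi> h (inv_into \<Gamma> (mean_value \<nu> \<phi> h) \<mu>)"

definition product_of_open_intervals :: "(real^'m) set \<Rightarrow> bool" where
  "product_of_open_intervals S \<longleftrightarrow>
     (\<exists>lo hi :: 'm \<Rightarrow> ereal. S = {\<mu>. \<forall>i. lo i < ereal (\<mu> $ i) \<and> ereal (\<mu> $ i) < hi i})"

section \<open>Likelihoods, Bayes marginals and the switch distribution\<close>

text \<open>
  A sample \<open>x\<^sup>n = (x\<^sub>1, \<dots>, x\<^sub>n)\<close> is a list of length \<open>n\<close>. The marginals take values in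
  \<open>ennreal\<close>, since the Bayes integral may be infinite on a null set of samples.
\<close>

definition likelihood :: "('a \<Rightarrow> real) \<Rightarrow> 'a list \<Rightarrow> real" where
  "likelihood q xs = prod_list (map q xs)"

definition prior_density :: "(real^'m) set \<Rightarrow> (real^'m \<Rightarrow> real) \<Rightarrow> bool" where
  "prior_density M \<omega> \<longleftrightarrow>
     continuous_on M \<omega> \<and> (\<forall>\<mu>\<in>M. 0 < \<omega> \<mu>) \<and>
     (\<integral>\<^sup>+\<mu>\<in>M. ennreal (\<omega> \<mu>) \<partial>lborel) = 1"

definition bayes_marginal ::
    "(real^'m) set \<Rightarrow> (real^'m \<Rightarrow> real) \<Rightarrow> (real^'m \<Rightarrow> 'a \<Rightarrow> real) \<Rightarrow> 'a list \<Rightarrow> ennreal" where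
  "bayes_marginal M \<omega> p xs = (\<integral>\<^sup>+\<mu>\<in>M. ennreal (\<omega> \<mu> * likelihood (p \<mu>) xs) \<partial>lborel)"

text \<open>
  Here \<open>p0\<close> and \<open>p1\<close> are the marginals of the two models, and \<open>take (t - 1) xs\<close> is the
  initial segment \<open>x\<^sup>t\<^sup>-\<^sup>1\<close>.
\<close>

definition switch_at ::
    "('a list \<Rightarrow> ennreal) \<Rightarrow> ('a list \<Rightarrow> ennreal) \<Rightarrow> nat \<Rightarrow> 'a list \<Rightarrow> ennreal" where
  "switch_at p0 p1 t xs =
     (if t \<le> length xs then p0 (take (t - 1) xs) * (p1 xs / p1 (take (t - 1) xs)) else p0 xs)"

text \<open>The sum over switch times starts at \<open>t = 1\<close>, hence the successors.\<close>

definition switch_marginal ::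
    "nat pmf \<Rightarrow> ('a list \<Rightarrow> ennreal) \<Rightarrow> ('a list \<Rightarrow> ennreal) \<Rightarrow> 'a list \<Rightarrow> ennreal" where
  "switch_marginal \<pi> p0 p1 xs = (\<Sum>t. ennreal (pmf \<pi> (Suc t)) * switch_at p0 p1 (Suc t) xs)"

definition switch_prior :: "real \<Rightarrow> nat pmf \<Rightarrow> bool" where
  "switch_prior \<kappa> \<pi> \<longleftrightarrow>
     set_pmf \<pi> = range (\<lambda>i. 2 ^ i) \<and>
     (\<lambda>i. pmf \<pi> (2 ^ i)) \<in> \<Theta>(\<lambda>i. real i powr (- \<kappa>))"

text \<open>
  The conversion to \<open>real\<close> loses nothing on samples from \<open>\<X>\<close>: there \<open>p0\<close> is finite, and
  the switch marginal is positive because \<open>\<pi>\<close> has unbounded support.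
\<close>

definition switch_ratio ::
    "nat pmf \<Rightarrow> ('a list \<Rightarrow> ennreal) \<Rightarrow> ('a list \<Rightarrow> ennreal) \<Rightarrow> 'a list \<Rightarrow> real" where
  "switch_ratio \<pi> p0 p1 xs = enn2real (p0 xs / switch_marginal \<pi> p0 p1 xs)"

section \<open>Model selection and robust null hypothesis tests\<close>

definition selection_rule :: "('a list \<Rightarrow> real) \<Rightarrow> real \<Rightarrow> 'a list \<Rightarrow> nat" where
  "selection_rule r t xs = (if r xs \<le> t then 1 else 0)"

definition iid_measure :: "'a measure \<Rightarrow> ('a \<Rightarrow> real) \<Rightarrow> (nat \<Rightarrow> 'a) measure" where
  "iid_measure \<nu> q = (\<Pi>\<^sub>M i\<in>UNIV. density \<nu> (\<lambda>x. ennreal (q x)))"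

text \<open>
  \<open>P \<mu>\<close> is the law of the data \<open>X\<^sub>1, X\<^sub>2, \<dots>\<close> (indexed from 0) under the parameter \<open>\<mu>\<close>.
  Measurability of the rejection event is required explicitly because \<open>measure\<close> is 0 on
  non-measurable sets.
\<close>

definition robust_null_test ::
    "'p set \<Rightarrow> ('p \<Rightarrow> (nat \<Rightarrow> 'a) measure) \<Rightarrow> ('a list \<Rightarrow> real) \<Rightarrow> (real \<Rightarrow> real) \<Rightarrow> bool" where
  "robust_null_test M0 P r t \<longleftrightarrow>
     (\<forall>\<mu>\<in>M0. \<forall>\<alpha>. 0 \<le> \<alpha> \<and> \<alpha> \<le> 1 \<longrightarrow>
        (let E = {x \<in> space (P \<mu>). \<exists>n. selection_rule r (t \<alpha>) (map x [0..<n]) = 1}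
         in E \<in> sets (P \<mu>) \<and> measure (P \<mu>) E \<le> \<alpha>))"

end

theory Submission
  imports Defs
begin

text \<open>
  The evidence \<open>p\<^sub>s\<^sub>w(x\<^sup>n) / p\<^sub>\<mu>\<^sub>0(x\<^sup>n)\<close> is a nonnegative supermartingale under \<open>\<mu>\<^sub>0\<close>
  with initial value at most 1: each component \<open>switch_at\<close> is, from the switch onwards, a
  likelihood ratio of a Bayes mixture, whose mean does not grow, by Tonelli. Ville's inequality
  bounds the probability that it ever reaches \<open>1 / \<alpha>\<close> by \<open>\<alpha>\<close>. Tonelli requires the densities to
  be jointly measurable in the mean-value parameter and the observation. This holds because the
  mean-value map is continuous and injective on an open set, so that its inverse is continuous
  by invariance of domain.
\<close>

section \<open>Ville's inequality for processes of finite prefixes\<close>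

text \<open>Functions of samples are functions of lists. Testing them on the prefixes of an infinite
  sequence avoids fixing a sigma-algebra on lists.\<close>

definition prefix_measurable :: "'a measure \<Rightarrow> ('a list \<Rightarrow> ennreal) \<Rightarrow> bool" where
  "prefix_measurable M g \<longleftrightarrow>
     (\<forall>n. (\<lambda>\<omega>. g (map \<omega> [0..<n])) \<in> borel_measurable (\<Pi>\<^sub>M i\<in>(UNIV::nat set). M))"

lemma map_case_nat_upt: "map (case_nat x \<omega>) [0..<Suc n] = x # map \<omega> [0..<n]"
  by (simp add: map_Suc_upt[symmetric] upt_conv_Cons del: upt_Suc)

text \<open>Prepending \<open>x\<close> is a measurable map of the sequence space, and it turns the
  prefix of length \<open>n\<close> into the prefix of length \<open>Suc n\<close>.\<close>

lemma prefix_measurable_Cons: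
  assumes "prefix_measurable M g" "x \<in> space M"
  shows "prefix_measurable M (\<lambda>ys. g (x # ys))"
  unfolding prefix_measurable_def
proof
  fix n
  have [measurable]: "(\<lambda>\<omega>. g (map \<omega> [0..<Suc n])) \<in> borel_measurable (\<Pi>\<^sub>M i\<in>(UNIV::nat set). M)"
    using assms(1) unfolding prefix_measurable_def by blast
  note [measurable] = assms(2)
  have "(\<lambda>\<omega>. g (map (case_nat x \<omega>) [0..<Suc n])) \<in> borel_measurable (\<Pi>\<^sub>M i\<in>(UNIV::nat set). M)"
    by (rule measurable_compose[where g = "\<lambda>\<omega>. g (map \<omega> [0..<Suc n])"]) measurable
  then show "(\<lambda>\<omega>. g (x # map \<omega> [0..<n])) \<in> borel_measurable (\<Pi>\<^sub>M i\<in>(UNIV::nat set). M)"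
    by (simp only: map_case_nat_upt)
qed

lemma prefix_measurable_append:
  assumes "prefix_measurable M g" "xs \<in> lists (space M)"
  shows "prefix_measurable M (\<lambda>ys. g (xs @ ys))"
  using assms
proof (induction xs arbitrary: g)
  case (Cons x xs)
  then show ?case
    using Cons.IH[OF prefix_measurable_Cons[of M g x]] by simp
qed simp

lemma prefix_measurable_snoc:
  assumes "prefix_measurable M g" "xs \<in> lists (space M)"
  shows "(\<lambda>x. g (xs @ [x])) \<in> borel_measurable M"
proof -
  have [measurable]: "(\<lambda>\<omega>. g (xs @ map \<omega> [0..<1])) \<in> borel_measurable (\<Pi>\<^sub>M i\<in>(UNIV::nat set). M)"
    using prefix_measurable_append[OF assms] unfolding prefix_measurable_def by blast
  \<comment> \<open>The constant sequence is a measurable function of its value, and its prefix of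
    length 1 is \<open>[x]\<close>.\<close>
  have "(\<lambda>x. (\<lambda>i::nat. x)) \<in> measurable M (\<Pi>\<^sub>M i\<in>UNIV. M)"
    by (rule measurable_PiM_single') (auto simp: space_PiM PiE_iff)
  then have "(\<lambda>x. g (xs @ map (\<lambda>i::nat. x) [0..<1])) \<in> borel_measurable M"
    by (rule measurable_compose) measurable
  then show ?thesis by simp
qed

text \<open>Conditioning on the first observation: the sequence measure is the image of
  \<open>M \<Otimes>\<^sub>M S\<close> under prepending, so an event can be measured section by
  section.\<close>

lemma (in sequence_space) emeasure_PiM_case_nat:
  assumes [measurable]: "E \<in> sets S"
  shows "emeasure S E = (\<integral>\<^sup>+x. emeasure S {\<omega> \<in> space S. case_nat x \<omega> \<in> E} \<partial>M)"
proof -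
  have "emeasure S E = emeasure (distr (M \<Otimes>\<^sub>M S) S (\<lambda>(s, \<omega>). case_nat s \<omega>)) E"
    by (simp add: PiM_iter)
  also have "\<dots> = emeasure (M \<Otimes>\<^sub>M S) ((\<lambda>(s, \<omega>). case_nat s \<omega>) -` E \<inter> space (M \<Otimes>\<^sub>M S))"
    by (rule emeasure_distr) measurable
  also have "\<dots> = (\<integral>\<^sup>+x. emeasure S (Pair x -` ((\<lambda>(s, \<omega>). case_nat s \<omega>) -` E \<inter> space (M \<Otimes>\<^sub>M S))) \<partial>M)"
    by (rule P.emeasure_pair_measure_alt) measurable
  also have "\<dots> = (\<integral>\<^sup>+x. emeasure S {\<omega> \<in> space S. case_nat x \<omega> \<in> E} \<partial>M)"
    by (intro nn_integral_cong arg_cong[where f = "emeasure S"]) (auto simp: space_pair_measure)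
  finally show ?thesis .
qed

lemma (in sequence_space) measurable_emeasure_case_nat:
  assumes "E \<in> sets S"
  shows "(\<lambda>x. emeasure S {\<omega> \<in> space S. case_nat x \<omega> \<in> E}) \<in> borel_measurable M"
proof -
  let ?Q = "(\<lambda>(x, \<omega>). case_nat x \<omega>) -` E \<inter> space (M \<Otimes>\<^sub>M S)"
  have "?Q \<in> sets (M \<Otimes>\<^sub>M S)"
    by (rule measurable_sets[OF _ assms]) measurable
  then have "(\<lambda>x. emeasure S (Pair x -` ?Q)) \<in> borel_measurable M"
    by (rule P.measurable_emeasure_Pair)
  moreover have "Pair x -` ?Q = {\<omega> \<in> space S. case_nat x \<omega> \<in> E}" if "x \<in> space M" for x
    using that by (auto simp: space_pair_measure)
  ultimately show ?thesis
    by (simp cong: measurable_cong)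
qed

lemma (in sequence_space) cmult_emeasure_PiM_case_nat:
  assumes "E \<in> sets S"
  shows "c * emeasure S E = (\<integral>\<^sup>+x. c * emeasure S {\<omega> \<in> space S. case_nat x \<omega> \<in> E} \<partial>M)"
  using measurable_emeasure_case_nat[OF assms]
  by (simp add: emeasure_PiM_case_nat[OF assms] nn_integral_cmult)

text \<open>Induction on the horizon, for all starting samples at once, replaces a stopping time. If
  \<open>g xs\<close> has reached \<open>c\<close>, a probability is at most 1. Otherwise the next
  observation is integrated out and the supermartingale property absorbs the step.\<close>

lemma (in sequence_space) Ville_inequality_finite:
  assumes g: "prefix_measurable M g"
    and super: "\<And>xs. xs \<in> lists (space M) \<Longrightarrow> (\<integral>\<^sup>+x. g (xs @ [x]) \<partial>M) \<le> g xs"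
    and xs: "xs \<in> lists (space M)"
  shows "c * emeasure S {\<omega> \<in> space S. \<exists>n\<le>N. c \<le> g (xs @ map \<omega> [0..<n])} \<le> g xs"
  using xs
proof (induction N arbitrary: xs)
  case 0
  have "{\<omega> \<in> space S. c \<le> g xs} = (if c \<le> g xs then space S else {})"
    by auto
  then show ?case
    by (simp add: P.emeasure_space_1 del: Collect_const)
next
  case (Suc N)
  let ?E = "\<lambda>N xs. {\<omega> \<in> space S. \<exists>n\<le>N. c \<le> g (xs @ map \<omega> [0..<n])}"
  show ?case
  proof (cases "c \<le> g xs")
    case True
    have "c * emeasure S (?E (Suc N) xs) \<le> c * 1"
      by (intro mult_left_mono P.emeasure_le_1) auto
    then show ?thesis using True by simp
  next
    case False
    have meas: "\<And>ys n. ys \<in> lists (space M) \<Longrightarrow> (\<lambda>\<omega>. g (ys @ map \<omega> [0..<n])) \<in> borel_measurable S"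
      using prefix_measurable_append[OF g] unfolding prefix_measurable_def by blast
    have sets: "?E (Suc N) xs \<in> sets S"
      using meas[OF Suc.prems] by measurable
    have "c * emeasure S (?E (Suc N) xs)
        = (\<integral>\<^sup>+x. c * emeasure S {\<omega> \<in> space S. case_nat x \<omega> \<in> ?E (Suc N) xs} \<partial>M)"
      by (rule cmult_emeasure_PiM_case_nat[OF sets])
    also have "\<dots> \<le> (\<integral>\<^sup>+x. g (xs @ [x]) \<partial>M)"
    proof (rule nn_integral_mono)
      fix x assume x: "x \<in> space M"
      then have xsx: "xs @ [x] \<in> lists (space M)"
        using Suc.prems by auto
      have "{\<omega> \<in> space S. case_nat x \<omega> \<in> ?E (Suc N) xs} \<subseteq> ?E N (xs @ [x])"
      proof (safe)
        fix \<omega> n assume n: "n \<le> Suc N" "c \<le> g (xs @ map (case_nat x \<omega>) [0..<n])"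
        \<comment> \<open>The empty continuation is excluded because \<open>g xs\<close> lies below
          \<open>c\<close>, so one observation is consumed and the horizon drops to
          \<open>N\<close>.\<close>
        with False obtain k where "n = Suc k" by (cases n) auto
        with n show "\<exists>n\<le>N. c \<le> g ((xs @ [x]) @ map \<omega> [0..<n])"
          by (intro exI[of _ k]) (simp add: map_case_nat_upt del: upt_Suc)
      qed
      moreover have "?E N (xs @ [x]) \<in> sets S"
        using meas[OF xsx] by measurable
      ultimately have "c * emeasure S {\<omega> \<in> space S. case_nat x \<omega> \<in> ?E (Suc N) xs}
          \<le> c * emeasure S (?E N (xs @ [x]))"
        by (rule mult_left_mono[OF emeasure_mono zero_le])
      also have "\<dots> \<le> g (xs @ [x])"
        by (rule Suc.IH[OF xsx])
      finally show "c * emeasure S {\<omega> \<in> space S. case_nat x \<omega> \<in> ?E (Suc N) xs} \<le> g (xs @ [x])" .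
    qed
    also have "\<dots> \<le> g xs"
      by (rule super) fact
    finally show ?thesis .
  qed
qed

text \<open>The bound is uniform in the horizon, and the events increase with it, so continuity from
  below applies.\<close>

lemma (in sequence_space) Ville_inequality:
  assumes g: "prefix_measurable M g"
    and super: "\<And>xs. xs \<in> lists (space M) \<Longrightarrow> (\<integral>\<^sup>+x. g (xs @ [x]) \<partial>M) \<le> g xs"
  shows "c * emeasure S {\<omega> \<in> space S. \<exists>n. c \<le> g (map \<omega> [0..<n])} \<le> g []"
proof -
  let ?E = "\<lambda>N. {\<omega> \<in> space S. \<exists>n\<le>N. c \<le> g (map \<omega> [0..<n])}"
  have meas: "\<And>n. (\<lambda>\<omega>. g (map \<omega> [0..<n])) \<in> borel_measurable S"
    using g unfolding prefix_measurable_def by blast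
  have E: "{\<omega> \<in> space S. \<exists>n. c \<le> g (map \<omega> [0..<n])} = (\<Union>N. ?E N)"
    by auto
  have "emeasure S (\<Union>N. ?E N) = (SUP N. emeasure S (?E N))"
  proof (rule SUP_emeasure_incseq[symmetric])
    show "range ?E \<subseteq> sets S"
    proof (rule image_subsetI)
      show "?E N \<in> sets S" for N
        using meas by measurable
    qed
    show "incseq ?E"
      by (rule incseq_SucI) (auto intro: le_SucI)
  qed
  then have "c * emeasure S (\<Union>N. ?E N) = (SUP N. c * emeasure S (?E N))"
    by (simp only: SUP_mult_left_ennreal)
  also have "\<dots> \<le> g []"
    using Ville_inequality_finite[OF g super, of "[]" c] by (intro SUP_least) simp
  finally show ?thesis by (simp only: E)
qed

section \<open>The evidence in favour of switching\<close>

lemma prefix_measurable_cong_sets: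
  "sets M = sets N \<Longrightarrow> prefix_measurable M g = prefix_measurable N g"
  unfolding prefix_measurable_def
  by (intro all_cong1 arg_cong2[where f = "(\<in>)"] refl measurable_cong_sets sets_PiM_cong)

lemma likelihood_Nil [simp]: "likelihood q [] = 1"
  by (simp add: likelihood_def)

lemma likelihood_snoc [simp]: "likelihood q (xs @ [x]) = likelihood q xs * q x"
  by (simp add: likelihood_def)

lemma likelihood_nonneg: "(\<And>x. x \<in> set xs \<Longrightarrow> 0 \<le> q x) \<Longrightarrow> 0 \<le> likelihood q xs"
  unfolding likelihood_def by (induction xs) auto

lemma likelihood_pos: "(\<And>x. x \<in> set xs \<Longrightarrow> 0 < q x) \<Longrightarrow> 0 < likelihood q xs"
  unfolding likelihood_def by (induction xs) auto

lemma likelihood_map_upt: "likelihood q (map \<omega> [0..<n]) = (\<Prod>i<n. q (\<omega> i))"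
  by (induction n) (simp_all)

lemma prefix_measurable_likelihood:
  assumes [measurable]: "q \<in> borel_measurable M"
  shows "prefix_measurable M (\<lambda>xs. ennreal (likelihood q xs))"
  unfolding prefix_measurable_def likelihood_map_upt by measurable

lemma prefix_measurable_switch_at:
  assumes "prefix_measurable M p0" "prefix_measurable M p1"
  shows "prefix_measurable M (switch_at p0 p1 t)"
proof -
  have [measurable]: "(\<lambda>\<omega>. p0 (map \<omega> [0..<n])) \<in> borel_measurable (\<Pi>\<^sub>M i\<in>(UNIV::nat set). M)"
    "(\<lambda>\<omega>. p1 (map \<omega> [0..<n])) \<in> borel_measurable (\<Pi>\<^sub>M i\<in>(UNIV::nat set). M)" for n
    using assms unfolding prefix_measurable_def by blast+
  \<comment> \<open>At a fixed length the case distinction does not depend on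
    \<open>\<omega>\<close>, and the initial segment is again a prefix of
    \<open>\<omega>\<close>.\<close>
  have "switch_at p0 p1 t (map \<omega> [0..<n]) =
      (if t \<le> n then p0 (map \<omega> [0..<t - 1]) * (p1 (map \<omega> [0..<n]) / p1 (map \<omega> [0..<t - 1]))
       else p0 (map \<omega> [0..<n]))" for n \<omega>
    by (auto simp: switch_at_def take_map)
  then show ?thesis
    unfolding prefix_measurable_def by simp
qed

lemma prefix_measurable_switch_marginal:
  assumes "prefix_measurable M p0" "prefix_measurable M p1"
  shows "prefix_measurable M (switch_marginal \<pi> p0 p1)"
proof -
  have [measurable]: "(\<lambda>\<omega>. switch_at p0 p1 t (map \<omega> [0..<n])) \<in> borel_measurable (\<Pi>\<^sub>M i\<in>(UNIV::nat set). M)" for n t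
    using prefix_measurable_switch_at[OF assms] unfolding prefix_measurable_def by blast
  show ?thesis
    unfolding prefix_measurable_def switch_marginal_def by measurable
qed

text \<open>Cancellation in \<open>ennreal\<close> fails at 0 and at infinity, so both are excluded
  for the cancelled factor and the remaining denominator. The numerator \<open>c\<close> may be
  infinite, as a Bayes marginal may be.\<close>

lemma ennreal_mult_divide_cancel:
  fixes a b c :: ennreal
  assumes "0 < a" "a < top" "0 < b" "b < top"
  shows "a * (c / (b * a)) = c / b"
proof -
  have "a * (c / (b * a)) = c * inverse b * (a * inverse a)"
    using assms by (simp add: divide_ennreal_def ennreal_inverse_mult mult_ac)
  also have "a * inverse a = 1"
    using assms by (metis divide_ennreal_def ennreal_divide_self less_irrefl)
  finally show ?thesis by (simp add: divide_ennreal_def)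
qed

text \<open>The sum is the mass of the positive integers; a mass at 0 would be missing from it,
  hence an inequality.\<close>

lemma suminf_pmf_Suc_le_1: "(\<Sum>t. ennreal (pmf \<pi> (Suc t))) \<le> 1"
proof -
  have "(\<Sum>t. ennreal (pmf \<pi> (Suc t))) = (\<integral>\<^sup>+t. ennreal (pmf \<pi> (Suc t)) \<partial>count_space UNIV)"
    by (simp add: nn_integral_count_space_nat)
  also have "\<dots> = emeasure (measure_pmf \<pi>) (range Suc)"
    by (subst nn_integral_bij_count_space[where g = Suc and B = "range Suc" and f = "\<lambda>t. ennreal (pmf \<pi> t)"])
       (auto simp: bij_betw_def nn_integral_pmf)
  also have "\<dots> \<le> 1"
    by (rule measure_pmf.emeasure_le_1)
  finally show ?thesis .
qed

text \<open>Abstracts from the Bayes mixture: \<open>p1\<close> is any measurable, possibly infinite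
  marginal that does not grow when the next observation is integrated out.\<close>

locale switch_from_simple_null =
  fixes \<nu> :: "'a measure" and q :: "'a \<Rightarrow> real" and p1 :: "'a list \<Rightarrow> ennreal"
  assumes q_measurable [measurable]: "q \<in> borel_measurable \<nu>"
    and q_pos: "\<And>x. x \<in> space \<nu> \<Longrightarrow> 0 < q x"
    and q_prob: "prob_space (density \<nu> (\<lambda>x. ennreal (q x)))"
    and p1_measurable: "prefix_measurable \<nu> p1"
    and p1_sub: "\<And>xs. xs \<in> lists (space \<nu>) \<Longrightarrow> (\<integral>\<^sup>+x. p1 (xs @ [x]) \<partial>\<nu>) \<le> p1 xs"
    and p1_Nil: "p1 [] = 1"
begin

abbreviation D where "D \<equiv> density \<nu> (\<lambda>x. ennreal (q x))"

abbreviation p0 where "p0 \<equiv> (\<lambda>xs. ennreal (likelihood q xs))"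

sublocale D: prob_space D
  by (rule q_prob)

sublocale sequence_space D
  by (simp add: sequence_space_def product_prob_space_def product_prob_space_axioms_def
      product_sigma_finite_def q_prob D.sigma_finite_measure_axioms)

lemma p0_pos: "xs \<in> lists (space \<nu>) \<Longrightarrow> 0 < p0 xs"
  using q_pos by (auto intro!: likelihood_pos)

lemma p0_snoc: "xs \<in> lists (space \<nu>) \<Longrightarrow> x \<in> space \<nu> \<Longrightarrow> p0 (xs @ [x]) = p0 xs * ennreal (q x)"
  using q_pos likelihood_nonneg[of xs q] by (subst likelihood_snoc, intro ennreal_mult) (force intro: less_imp_le)+

text \<open>
  Integrating against \<open>q\<close> cancels the last factor of the denominator. Only at time \<open>t\<close> itself is
  there a loss, when \<open>p1 xs \<in> {0, \<infinity>}\<close> makes \<open>p1 xs / p1 xs = 0\<close>.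
\<close>

lemma nn_integral_switch_at_le:
  assumes xs: "xs \<in> lists (space \<nu>)" and t: "1 \<le> t"
  shows "(\<integral>\<^sup>+x. switch_at p0 p1 t (xs @ [x]) / p0 (xs @ [x]) \<partial>D) \<le> switch_at p0 p1 t xs / p0 xs"
proof -
  note [measurable] = prefix_measurable_snoc[OF p1_measurable xs]
    prefix_measurable_snoc[OF prefix_measurable_switch_at[OF prefix_measurable_likelihood[OF q_measurable] p1_measurable] xs]
    prefix_measurable_snoc[OF prefix_measurable_likelihood[OF q_measurable] xs]
  have P: "0 < p0 xs" "p0 xs < top"
    using p0_pos[OF xs] by auto
  have one: "p0 xs / p0 xs = 1"
    using P by simp
  have "(\<integral>\<^sup>+x. switch_at p0 p1 t (xs @ [x]) / p0 (xs @ [x]) \<partial>D)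
      = (\<integral>\<^sup>+x. ennreal (q x) * (switch_at p0 p1 t (xs @ [x]) / p0 (xs @ [x])) \<partial>\<nu>)"
    by (rule nn_integral_density) measurable
  also have "\<dots> = (\<integral>\<^sup>+x. ennreal (q x) * (switch_at p0 p1 t (xs @ [x]) / (p0 xs * ennreal (q x))) \<partial>\<nu>)"
    using p0_snoc[OF xs] by (intro nn_integral_cong) (simp only:)
  finally have int: "(\<integral>\<^sup>+x. switch_at p0 p1 t (xs @ [x]) / p0 (xs @ [x]) \<partial>D) = \<dots>" .
  \<comment> \<open>The new observation has index \<open>Suc (length xs)\<close>: it comes after the
    switch, is the first one predicted by \<open>p1\<close>, or still precedes the switch.\<close>
  consider "t \<le> length xs" | "t = Suc (length xs)" | "Suc (length xs) < t"
    by linarith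
  then show ?thesis
  proof cases
    case 1
    \<comment> \<open>All factors determined by \<open>xs\<close> alone; only
      \<open>p1 (xs @ [x])\<close> depends on the new observation.\<close>
    let ?K = "p0 (take (t - 1) xs) * inverse (p1 (take (t - 1) xs)) * inverse (p0 xs)"
    have "(\<integral>\<^sup>+x. ennreal (q x) * (switch_at p0 p1 t (xs @ [x]) / (p0 xs * ennreal (q x))) \<partial>\<nu>)
        = (\<integral>\<^sup>+x. ?K * p1 (xs @ [x]) \<partial>\<nu>)"
    proof (rule nn_integral_cong)
      fix x assume "x \<in> space \<nu>"
      then have "ennreal (q x) * (switch_at p0 p1 t (xs @ [x]) / (p0 xs * ennreal (q x)))
          = switch_at p0 p1 t (xs @ [x]) / p0 xs"
        using P q_pos by (intro ennreal_mult_divide_cancel) auto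
      also have "\<dots> = ?K * p1 (xs @ [x])"
        using 1 t by (simp add: switch_at_def divide_ennreal_def mult_ac)
      finally show "ennreal (q x) * (switch_at p0 p1 t (xs @ [x]) / (p0 xs * ennreal (q x))) = ?K * p1 (xs @ [x])" .
    qed
    also have "\<dots> = ?K * (\<integral>\<^sup>+x. p1 (xs @ [x]) \<partial>\<nu>)"
      by (rule nn_integral_cmult) measurable
    also have "\<dots> \<le> ?K * p1 xs"
      by (intro mult_left_mono p1_sub xs) auto
    also have "\<dots> = switch_at p0 p1 t xs / p0 xs"
      using 1 by (simp add: switch_at_def divide_ennreal_def mult_ac)
    finally show ?thesis
      unfolding int .
  next
    case 2
    have "(\<integral>\<^sup>+x. ennreal (q x) * (switch_at p0 p1 t (xs @ [x]) / (p0 xs * ennreal (q x))) \<partial>\<nu>)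
        = (\<integral>\<^sup>+x. inverse (p1 xs) * p1 (xs @ [x]) \<partial>\<nu>)"
    proof (rule nn_integral_cong)
      fix x assume "x \<in> space \<nu>"
      then have "ennreal (q x) * (switch_at p0 p1 t (xs @ [x]) / (p0 xs * ennreal (q x)))
          = switch_at p0 p1 t (xs @ [x]) / p0 xs"
        using P q_pos by (intro ennreal_mult_divide_cancel) auto
      \<comment> \<open>Since \<open>t - 1 = length xs\<close>, the initial segment is
        \<open>xs\<close> itself. Its null likelihood cancels and the conditional density of the new
        observation remains.\<close>
      also have "\<dots> = (p0 xs / p0 xs) * (inverse (p1 xs) * p1 (xs @ [x]))"
        using 2 by (simp add: switch_at_def divide_ennreal_def mult_ac)
      finally show "ennreal (q x) * (switch_at p0 p1 t (xs @ [x]) / (p0 xs * ennreal (q x)))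
          = inverse (p1 xs) * p1 (xs @ [x])"
        by (simp only: one mult_1)
    qed
    also have "\<dots> = inverse (p1 xs) * (\<integral>\<^sup>+x. p1 (xs @ [x]) \<partial>\<nu>)"
      by (rule nn_integral_cmult) measurable
    also have "\<dots> \<le> p1 xs / p1 xs"
      unfolding divide_ennreal_def mult.commute[of "p1 xs"]
      by (intro mult_left_mono p1_sub xs) auto
    also have "\<dots> \<le> 1"
      by (cases "p1 xs = 0"; cases "p1 xs = top") (auto simp: less_top[symmetric])
    also have "1 = switch_at p0 p1 t xs / p0 xs"
      using 2 one by (simp add: switch_at_def)
    finally show ?thesis
      unfolding int .
  next
    case 3
    have "(\<integral>\<^sup>+x. switch_at p0 p1 t (xs @ [x]) / p0 (xs @ [x]) \<partial>D) = (\<integral>\<^sup>+x. 1 \<partial>D)"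
    proof (rule nn_integral_cong)
      fix x assume "x \<in> space D"
      then have "0 < p0 (xs @ [x])"
        using xs by (intro p0_pos) auto
      then show "switch_at p0 p1 t (xs @ [x]) / p0 (xs @ [x]) = 1"
        using 3 by (simp add: switch_at_def del: likelihood_snoc)
    qed
    also have "\<dots> = 1"
      using D.emeasure_space_1 by simp
    also have "1 = switch_at p0 p1 t xs / p0 xs"
      using 3 one by (simp add: switch_at_def)
    finally show ?thesis by simp
  qed
qed

abbreviation evidence :: "nat pmf \<Rightarrow> 'a list \<Rightarrow> ennreal" where
  "evidence \<pi> xs \<equiv> switch_marginal \<pi> p0 p1 xs / p0 xs"

lemma prefix_measurable_switch:
  "prefix_measurable D p0" "prefix_measurable D (switch_marginal \<pi> p0 p1)"
proof -
  have 0: "prefix_measurable D p0"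
    by (rule prefix_measurable_likelihood) simp
  have "prefix_measurable D p1"
    using p1_measurable prefix_measurable_cong_sets[of D \<nu>] by simp
  with 0 show "prefix_measurable D p0" "prefix_measurable D (switch_marginal \<pi> p0 p1)"
    by (auto intro: prefix_measurable_switch_marginal)
qed

lemma evidence_eq: "evidence \<pi> xs = (\<Sum>t. ennreal (pmf \<pi> (Suc t)) * (switch_at p0 p1 (Suc t) xs / p0 xs))"
  by (simp add: switch_marginal_def ennreal_times_divide)

text \<open>The weights do not depend on the sample, and all terms are nonnegative, so the bounds
  for the single switch times may be summed under the integral.\<close>

lemma nn_integral_evidence_le:
  assumes xs: "xs \<in> lists (space \<nu>)"
  shows "(\<integral>\<^sup>+x. evidence \<pi> (xs @ [x]) \<partial>D) \<le> evidence \<pi> xs"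
proof -
  note [measurable] =
    prefix_measurable_snoc[OF prefix_measurable_switch_at[OF prefix_measurable_likelihood[OF q_measurable] p1_measurable] xs]
    prefix_measurable_snoc[OF prefix_measurable_likelihood[OF q_measurable] xs]
  have "(\<integral>\<^sup>+x. evidence \<pi> (xs @ [x]) \<partial>D)
      = (\<Sum>t. \<integral>\<^sup>+x. ennreal (pmf \<pi> (Suc t)) * (switch_at p0 p1 (Suc t) (xs @ [x]) / p0 (xs @ [x])) \<partial>D)"
    unfolding evidence_eq by (rule nn_integral_suminf) measurable
  also have "\<dots> = (\<Sum>t. ennreal (pmf \<pi> (Suc t)) * (\<integral>\<^sup>+x. switch_at p0 p1 (Suc t) (xs @ [x]) / p0 (xs @ [x]) \<partial>D))"
    by (intro suminf_cong nn_integral_cmult) measurable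
  also have "\<dots> \<le> evidence \<pi> xs"
    unfolding evidence_eq by (intro suminf_le mult_left_mono nn_integral_switch_at_le xs) auto
  finally show ?thesis .
qed

text \<open>Switch times start at 1, so on the empty sample every component is still the null
  likelihood and has ratio 1.\<close>

lemma evidence_Nil_le: "evidence \<pi> [] \<le> 1"
proof -
  have "switch_at p0 p1 (Suc t) [] / p0 [] = 1" for t
    by (simp add: switch_at_def ennreal_divide_self del: ennreal_1)
  then show ?thesis
    unfolding evidence_eq using suminf_pmf_Suc_le_1[of \<pi>] by simp
qed

text \<open>Some switch time of positive mass lies beyond the end of the sample, and its component
  equals the positive null likelihood.\<close>

lemma switch_marginal_pos:
  assumes xs: "xs \<in> lists (space \<nu>)" and "infinite (set_pmf \<pi>)"
  shows "0 < switch_marginal \<pi> p0 p1 xs"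
proof -
  obtain t where t: "t \<in> set_pmf \<pi>" "Suc (length xs) \<le> t"
    using assms(2) unfolding infinite_nat_iff_unbounded_le by blast
  then obtain s where s: "t = Suc s" by (cases t) auto
  have "0 < ennreal (pmf \<pi> t) * p0 xs"
    using t p0_pos[OF xs] by (simp add: pmf_positive ennreal_zero_less_mult_iff)
  also have "\<dots> = ennreal (pmf \<pi> (Suc s)) * switch_at p0 p1 (Suc s) xs"
    using t s by (simp add: switch_at_def)
  also have "\<dots> \<le> switch_marginal \<pi> p0 p1 xs"
    unfolding switch_marginal_def
    using sum_le_suminf[of "\<lambda>t. ennreal (pmf \<pi> (Suc t)) * switch_at p0 p1 (Suc t) xs" "{s}"] by simp
  finally show ?thesis .
qed

text \<open>\<open>enn2real\<close> sends infinity to 0, so a small real ratio could be spurious.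
  Positivity of the switch marginal rules out an infinite ratio; an infinite marginal gives ratio 0,
  but then the evidence is infinite as well.\<close>

lemma switch_ratio_le_imp_evidence_ge:
  assumes xs: "xs \<in> lists (space \<nu>)" and inf: "infinite (set_pmf \<pi>)" and \<alpha>: "0 < \<alpha>"
    and le: "switch_ratio \<pi> p0 p1 xs \<le> \<alpha>"
  shows "ennreal (1 / \<alpha>) \<le> evidence \<pi> xs"
proof (cases "switch_marginal \<pi> p0 p1 xs")
  case (real w)
  let ?l = "likelihood q xs"
  have w: "0 < w" and l: "0 < ?l"
    using switch_marginal_pos[OF xs inf] p0_pos[OF xs] real by (auto simp: ennreal_less_zero_iff)
  have "?l / w \<le> \<alpha>"
    using le w l by (simp add: switch_ratio_def real divide_ennreal)
  then have "1 / \<alpha> \<le> w / ?l"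
    using w l \<alpha> by (simp add: field_simps)
  then show ?thesis
    using w l by (simp add: real divide_ennreal ennreal_leI)
next
  case top
  then show ?thesis
    by (simp add: ennreal_top_divide)
qed

text \<open>Rejection at level \<open>\<alpha>\<close> forces the evidence up to
  \<open>1 / \<alpha>\<close>, which Ville's inequality controls. The rejection event is measurable
  as a countable union over sample sizes.\<close>

lemma robust_null_test_switch_ratio:
  assumes inf: "infinite (set_pmf \<pi>)" and P: "P \<mu> = iid_measure \<nu> q"
  shows "robust_null_test {\<mu>} P (switch_ratio \<pi> p0 p1) (\<lambda>\<alpha>. \<alpha>)"
proof -
  have PS: "P \<mu> = S"
    by (simp add: P iid_measure_def)
  let ?E = "\<lambda>\<alpha>. {x \<in> space S. \<exists>n. switch_ratio \<pi> p0 p1 (map x [0..<n]) \<le> \<alpha>}"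
  have [measurable]: "(\<lambda>\<omega>. p0 (map \<omega> [0..<n])) \<in> borel_measurable S"
    "(\<lambda>\<omega>. switch_marginal \<pi> p0 p1 (map \<omega> [0..<n])) \<in> borel_measurable S" for n
    using prefix_measurable_switch unfolding prefix_measurable_def by blast+
  have E: "?E \<alpha> \<in> sets S" for \<alpha>
    unfolding switch_ratio_def by measurable
  have pos: "measure S (?E \<alpha>) \<le> \<alpha>" if \<alpha>: "0 < \<alpha>" for \<alpha>
  proof -
    let ?F = "{\<omega> \<in> space S. \<exists>n. ennreal (1 / \<alpha>) \<le> evidence \<pi> (map \<omega> [0..<n])}"
    have "prefix_measurable D (evidence \<pi>)"
      unfolding prefix_measurable_def by measurable
    then have "ennreal (1 / \<alpha>) * emeasure S ?F \<le> evidence \<pi> []"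
      using nn_integral_evidence_le by (intro Ville_inequality) auto
    also have "\<dots> \<le> 1"
      by (rule evidence_Nil_le)
    finally have "ennreal \<alpha> * (ennreal (1 / \<alpha>) * emeasure S ?F) \<le> ennreal \<alpha>"
      using mult_left_mono by fastforce
    then have F: "emeasure S ?F \<le> ennreal \<alpha>"
      using \<alpha> by (simp add: mult.assoc[symmetric] ennreal_mult[symmetric])
    have "?E \<alpha> \<subseteq> ?F"
    proof (safe)
      fix \<omega> n assume "\<omega> \<in> space S" and le: "switch_ratio \<pi> p0 p1 (map \<omega> [0..<n]) \<le> \<alpha>"
      then have "map \<omega> [0..<n] \<in> lists (space \<nu>)"
        by (auto simp: space_PiM PiE_iff)
      from switch_ratio_le_imp_evidence_ge[OF this inf \<alpha> le]
      show "\<exists>n. ennreal (1 / \<alpha>) \<le> evidence \<pi> (map \<omega> [0..<n])" by blast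
    qed
    then have "emeasure S (?E \<alpha>) \<le> emeasure S ?F"
      by (intro emeasure_mono) measurable
    with F have "emeasure S (?E \<alpha>) \<le> ennreal \<alpha>"
      by order
    then show ?thesis
      using \<alpha> by (simp add: P.emeasure_eq_measure)
  qed
  \<comment> \<open>At level 0 the threshold \<open>1 / \<alpha>\<close> degenerates to 0. The
    events grow with the level, so the bounds at \<open>\<alpha> + e\<close> for all
    \<open>e > 0\<close> settle this case.\<close>
  have "measure S (?E \<alpha>) \<le> \<alpha>" if \<alpha>: "0 \<le> \<alpha>" for \<alpha>
  proof (rule field_le_epsilon)
    fix e :: real assume e: "0 < e"
    have "?E \<alpha> \<subseteq> ?E (\<alpha> + e)"
    proof safe
      fix x n assume "switch_ratio \<pi> p0 p1 (map x [0..<n]) \<le> \<alpha>"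
      with e show "\<exists>n. switch_ratio \<pi> p0 p1 (map x [0..<n]) \<le> \<alpha> + e"
        by (intro exI[of _ n]) linarith
    qed
    then have "measure S (?E \<alpha>) \<le> measure S (?E (\<alpha> + e))"
      by (rule P.finite_measure_mono[OF _ E])
    also have "\<dots> \<le> \<alpha> + e"
      using \<alpha> e by (intro pos) simp
    finally show "measure S (?E \<alpha>) \<le> \<alpha> + e" .
  qed
  note size = this
  have rule_eq: "selection_rule r \<alpha> xs = 1 \<longleftrightarrow> r xs \<le> \<alpha>" for r :: "'a list \<Rightarrow> real" and \<alpha> xs
    by (simp add: selection_rule_def)
  show ?thesis
    unfolding robust_null_test_def Let_def rule_eq
  proof (intro ballI allI impI conjI)
    fix \<mu>' \<alpha> assume "\<mu>' \<in> {\<mu>}"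
    then have eq: "P \<mu>' = S" by (simp only: PS singleton_iff)
    show "{x \<in> space (P \<mu>'). \<exists>n. switch_ratio \<pi> p0 p1 (map x [0..<n]) \<le> \<alpha>} \<in> sets (P \<mu>')"
      unfolding eq by (rule E)
    assume "0 \<le> \<alpha> \<and> \<alpha> \<le> 1"
    then show "measure (P \<mu>') {x \<in> space (P \<mu>'). \<exists>n. switch_ratio \<pi> p0 p1 (map x [0..<n]) \<le> \<alpha>} \<le> \<alpha>"
      unfolding eq using size by (elim conjE)
  qed
qed

end

section \<open>Exponential families\<close>

text \<open>A linear function on a polytope is at most its maximum over the vertices. Summing over
  all vertices gives a bound that does not depend on \<open>\<theta>\<close>.\<close>

lemma exp_inner_le_sum_vertices:
  fixes \<theta> y :: "'a::real_inner"
  assumes "finite V" "\<theta> \<in> convex hull V"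
  shows "exp (\<theta> \<bullet> y) \<le> (\<Sum>v\<in>V. exp (v \<bullet> y))"
proof -
  have "convex_on (convex hull V) (\<lambda>\<theta>. \<theta> \<bullet> y)"
    by (intro convex_onI) (auto simp: inner_add_left)
  then have "\<theta> \<bullet> y \<le> Max ((\<lambda>v. v \<bullet> y) ` V)"
    using assms(2) convex_on_convex_hull_bound[of V "\<lambda>\<theta>. \<theta> \<bullet> y" "Max ((\<lambda>v. v \<bullet> y) ` V)"]
    by (simp add: assms(1))
  moreover have "Max ((\<lambda>v. v \<bullet> y) ` V) \<in> (\<lambda>v. v \<bullet> y) ` V"
    using assms by (intro Max_in) auto
  ultimately obtain v where "v \<in> V" "\<theta> \<bullet> y \<le> v \<bullet> y"
    by auto
  then have "exp (\<theta> \<bullet> y) \<le> exp (v \<bullet> y)" by simp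
  also have "\<dots> \<le> (\<Sum>v\<in>V. exp (v \<bullet> y))"
    using assms(1) \<open>v \<in> V\<close> by (intro member_le_sum) auto
  finally show ?thesis .
qed

locale exp_family =
  fixes \<X> :: "(real^'d) set" and \<nu> :: "(real^'d) measure"
    and \<phi> :: "real^'d \<Rightarrow> real^'m" and h :: "real^'d \<Rightarrow> real" and \<Gamma> :: "(real^'m) set"
  assumes exponential_family: "exponential_family \<X> \<nu> \<phi> h \<Gamma>"
begin

lemma space_eq: "space \<nu> = \<X>"
  using exponential_family sets_eq_imp_space_eq[of \<nu> "restrict_space borel \<X>"]
  by (simp add: exponential_family_def space_restrict_space)

lemma \<phi>_measurable [measurable]: "\<phi> \<in> borel_measurable \<nu>"
  and h_measurable [measurable]: "h \<in> borel_measurable \<nu>"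
  and h_pos: "x \<in> space \<nu> \<Longrightarrow> 0 < h x"
  and open_\<Gamma>: "open \<Gamma>"
  and integrable_exp: "\<theta> \<in> \<Gamma> \<Longrightarrow> integrable \<nu> (\<lambda>x. exp (\<theta> \<bullet> \<phi> x) * h x)"
  using exponential_family space_eq
  by (auto simp: exponential_family_def)

lemma minimal: "AE x in \<nu>. a \<bullet> \<phi> x = c \<Longrightarrow> a = 0"
  using exponential_family unfolding exponential_family_def minimal_representation_def by blast

text \<open>
  By convexity of \<open>\<lambda>\<theta>. exp (\<theta> \<bullet> \<phi> x)\<close> the vertices of a small box around a point of \<open>\<Gamma>\<close> give one
  integrable bound near that point. The margin \<open>e\<close> absorbs the factor \<open>norm (\<phi> x)\<close>, because
  \<open>e * r \<le> exp (e * r)\<close>.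
\<close>

lemma local_domination:
  assumes "\<theta>0 \<in> \<Gamma>"
  obtains e W where "0 < e" "ball \<theta>0 e \<subseteq> \<Gamma>" "integrable \<nu> W"
    "\<And>\<theta> x. \<theta> \<in> ball \<theta>0 e \<Longrightarrow> x \<in> space \<nu> \<Longrightarrow> exp (\<theta> \<bullet> \<phi> x) * h x \<le> W x"
    "\<And>\<theta> x. \<theta> \<in> ball \<theta>0 e \<Longrightarrow> x \<in> space \<nu> \<Longrightarrow> e * (exp (\<theta> \<bullet> \<phi> x) * h x * norm (\<phi> x)) \<le> W x"
proof -
  obtain a b where ab: "cbox a b \<subseteq> \<Gamma>" "\<theta>0 \<in> box a b"
    using open_contains_cbox[OF open_\<Gamma> assms] by metis
  obtain d where d: "0 < d" "ball \<theta>0 d \<subseteq> box a b"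
    using ab(2) open_box[of a b] open_contains_ball by blast
  obtain V where V: "finite V" "cbox a b = convex hull V"
    using closed_interval_as_convex_hull by blast
  define W where "W x = (\<Sum>v\<in>V. exp (v \<bullet> \<phi> x) * h x)" for x
  have bound: "exp (\<theta> \<bullet> \<phi> x) * h x \<le> W x" if "\<theta> \<in> ball \<theta>0 d" "x \<in> space \<nu>" for \<theta> x
  proof -
    have "\<theta> \<in> convex hull V"
      using that(1) d(2) box_subset_cbox[of a b] V(2) by blast
    then have "exp (\<theta> \<bullet> \<phi> x) * h x \<le> (\<Sum>v\<in>V. exp (v \<bullet> \<phi> x)) * h x"
      using exp_inner_le_sum_vertices[OF V(1)] h_pos[OF that(2)] by (intro mult_right_mono) auto
    then show ?thesis by (simp add: W_def sum_distrib_right)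
  qed
  show thesis
  proof
    show "0 < d / 2" using d by simp
    have "ball \<theta>0 (d / 2) \<subseteq> ball \<theta>0 d" using d by (intro subset_ball) simp
    then show "ball \<theta>0 (d / 2) \<subseteq> \<Gamma>"
      using d(2) ab(1) box_subset_cbox[of a b] by blast
    have "V \<subseteq> \<Gamma>"
      using ab(1) V(2) hull_subset[of V convex] by blast
    then show "integrable \<nu> W"
      unfolding W_def by (intro Bochner_Integration.integrable_sum integrable_exp) auto
    fix \<theta> x assume \<theta>: "\<theta> \<in> ball \<theta>0 (d / 2)" and x: "x \<in> space \<nu>"
    then show "exp (\<theta> \<bullet> \<phi> x) * h x \<le> W x"
      using d by (intro bound) auto
    \<comment> \<open>A shift in the direction of \<open>\<phi> x\<close> raises the exponent by
      \<open>(d / 2) * norm (\<phi> x)\<close>. Halving the radius of the ball leaves room for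
      it.\<close>
    let ?u = "(d / 2) *\<^sub>R sgn (\<phi> x)"
    have "norm ?u \<le> d / 2"
      using d(1) by (auto simp: norm_sgn)
    then have "\<theta> + ?u \<in> ball \<theta>0 d"
      using \<theta> norm_triangle_ineq[of "\<theta> - \<theta>0" ?u] by (simp add: dist_norm norm_minus_commute algebra_simps)
    then have "exp ((\<theta> + ?u) \<bullet> \<phi> x) * h x \<le> W x"
      using x by (rule bound)
    moreover have "(\<theta> + ?u) \<bullet> \<phi> x = \<theta> \<bullet> \<phi> x + (d / 2) * norm (\<phi> x)"
      by (cases "\<phi> x = 0") (simp_all add: inner_add_left sgn_div_norm dot_square_norm power2_eq_square)
    moreover have "(d / 2) * norm (\<phi> x) \<le> exp ((d / 2) * norm (\<phi> x))"
      using exp_ge_add_one_self[of "(d / 2) * norm (\<phi> x)"] by linarith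
    then have "(exp (\<theta> \<bullet> \<phi> x) * h x) * ((d / 2) * norm (\<phi> x))
        \<le> (exp (\<theta> \<bullet> \<phi> x) * h x) * exp ((d / 2) * norm (\<phi> x))"
      using h_pos[OF x] by (intro mult_left_mono) auto
    ultimately show "d / 2 * (exp (\<theta> \<bullet> \<phi> x) * h x * norm (\<phi> x)) \<le> W x"
      by (simp add: exp_add mult_ac)
  qed
qed

section \<open>The partition function and the unnormalized mean: integrability, continuity,
  positivity\<close>

definition Z where "Z \<theta> = (\<integral>x. exp (\<theta> \<bullet> \<phi> x) * h x \<partial>\<nu>)"

definition unnormalized_mean where
  "unnormalized_mean \<theta> = (\<integral>x. (exp (\<theta> \<bullet> \<phi> x) * h x) *\<^sub>R \<phi> x \<partial>\<nu>)"

text \<open>The local bound, taken at the centre of the ball and divided by the margin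
  \<open>e\<close>, dominates the integrand.\<close>

lemma integrable_exp_\<phi>:
  assumes "\<theta> \<in> \<Gamma>"
  shows "integrable \<nu> (\<lambda>x. (exp (\<theta> \<bullet> \<phi> x) * h x) *\<^sub>R \<phi> x)"
proof -
  obtain e W where e: "0 < e" and W: "integrable \<nu> W"
    "\<And>\<theta>' x. \<theta>' \<in> ball \<theta> e \<Longrightarrow> x \<in> space \<nu> \<Longrightarrow> e * (exp (\<theta>' \<bullet> \<phi> x) * h x * norm (\<phi> x)) \<le> W x"
    using local_domination[OF assms] by metis
  show ?thesis
  proof (rule Bochner_Integration.integrable_bound)
    show "integrable \<nu> (\<lambda>x. W x / e)" using W by simp
    show "AE x in \<nu>. norm ((exp (\<theta> \<bullet> \<phi> x) * h x) *\<^sub>R \<phi> x) \<le> norm (W x / e)"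
    proof (rule AE_I2)
      fix x assume x: "x \<in> space \<nu>"
      have "exp (\<theta> \<bullet> \<phi> x) * h x * norm (\<phi> x) \<le> W x / e"
        using W(2)[of \<theta> x] x e by (simp add: pos_le_divide_eq mult_ac)
      also have "\<dots> \<le> norm (W x / e)"
        unfolding real_norm_def by (rule abs_ge_self)
      finally show "norm ((exp (\<theta> \<bullet> \<phi> x) * h x) *\<^sub>R \<phi> x) \<le> norm (W x / e)"
        using h_pos[OF x] by simp
    qed
  qed measurable
qed

text \<open>Dominated convergence along a sequence. The local bound applies only once the sequence
  has entered the ball, hence the shift by \<open>N\<close>.\<close>

lemma continuous_on_Z: "continuous_on \<Gamma> Z"
  and continuous_on_unnormalized_mean: "continuous_on \<Gamma> unnormalized_mean"
proof -
  have "(\<lambda>n. Z (u n)) \<longlonglongrightarrow> Z \<theta> \<and> (\<lambda>n. unnormalized_mean (u n)) \<longlonglongrightarrow> unnormalized_mean \<theta>"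
    if u: "\<forall>n. u n \<in> \<Gamma>" "u \<longlonglongrightarrow> \<theta>" and \<theta>: "\<theta> \<in> \<Gamma>" for u \<theta>
  proof -
    obtain e W where e: "0 < e" and W: "integrable \<nu> W"
      "\<And>\<theta>' x. \<theta>' \<in> ball \<theta> e \<Longrightarrow> x \<in> space \<nu> \<Longrightarrow> exp (\<theta>' \<bullet> \<phi> x) * h x \<le> W x"
      "\<And>\<theta>' x. \<theta>' \<in> ball \<theta> e \<Longrightarrow> x \<in> space \<nu> \<Longrightarrow> e * (exp (\<theta>' \<bullet> \<phi> x) * h x * norm (\<phi> x)) \<le> W x"
      using local_domination[OF \<theta>] by metis
    have "eventually (\<lambda>n. u n \<in> ball \<theta> e) sequentially"
      using u(2) e by (simp add: tendsto_iff dist_commute)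
    then obtain N where N: "\<And>n. n \<ge> N \<Longrightarrow> u n \<in> ball \<theta> e"
      by (auto simp: eventually_sequentially)
    have lim: "(\<lambda>n. exp (u (n + N) \<bullet> \<phi> x) * h x) \<longlonglongrightarrow> exp (\<theta> \<bullet> \<phi> x) * h x" for x
      by (intro tendsto_intros LIMSEQ_ignore_initial_segment u(2))
    have "(\<lambda>n. Z (u (n + N))) \<longlonglongrightarrow> Z \<theta>"
      unfolding Z_def
    proof (rule integral_dominated_convergence[where w = W])
      show "AE x in \<nu>. norm (exp (u (n + N) \<bullet> \<phi> x) * h x) \<le> W x" for n
        using W(2)[OF N[of "n + N"]] h_pos by (auto intro!: AE_I2 simp: abs_mult abs_of_pos)
    qed (use W lim in auto)
    moreover have "(\<lambda>n. unnormalized_mean (u (n + N))) \<longlonglongrightarrow> unnormalized_mean \<theta>"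
      unfolding unnormalized_mean_def
    proof (rule integral_dominated_convergence[where w = "\<lambda>x. W x / e"])
      show "AE x in \<nu>. norm ((exp (u (n + N) \<bullet> \<phi> x) * h x) *\<^sub>R \<phi> x) \<le> W x / e" for n
        using W(3)[OF N[of "n + N"]] h_pos e
        by (auto intro!: AE_I2 simp: abs_mult abs_of_pos pos_le_divide_eq mult_ac)
      show "AE x in \<nu>. (\<lambda>n. (exp (u (n + N) \<bullet> \<phi> x) * h x) *\<^sub>R \<phi> x) \<longlonglongrightarrow> (exp (\<theta> \<bullet> \<phi> x) * h x) *\<^sub>R \<phi> x"
        by (intro AE_I2 tendsto_intros lim)
    qed (use W in auto)
    ultimately show ?thesis
      by (auto dest: LIMSEQ_offset)
  qed
  then show "continuous_on \<Gamma> Z" "continuous_on \<Gamma> unnormalized_mean"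
    by (auto intro!: continuous_on_sequentiallyI)
qed

text \<open>On a null space every affine relation holds almost everywhere, against minimality. The
  vector \<open>axis undefined 1\<close> is a unit vector in an arbitrary coordinate; being nonzero
  is all that matters.\<close>

lemma space_not_null: "\<not> (AE x in \<nu>. False)"
proof
  assume "AE x in \<nu>. False"
  then have "AE x in \<nu>. axis undefined 1 \<bullet> \<phi> x = 0"
    by eventually_elim simp
  from minimal[OF this] show False
    by (simp add: axis_eq_0_iff)
qed

text \<open>A strictly positive function with integral 0 would make the whole space null.\<close>

lemma Z_pos: "\<theta> \<in> \<Gamma> \<Longrightarrow> 0 < Z \<theta>"
proof -
  assume \<theta>: "\<theta> \<in> \<Gamma>"
  have nn: "AE x in \<nu>. 0 \<le> exp (\<theta> \<bullet> \<phi> x) * h x"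
    using h_pos by (auto intro!: AE_I2 less_imp_le)
  have "Z \<theta> \<noteq> 0"
  proof
    assume "Z \<theta> = 0"
    then have "AE x in \<nu>. exp (\<theta> \<bullet> \<phi> x) * h x = 0"
      using integral_nonneg_eq_0_iff_AE[OF integrable_exp[OF \<theta>] nn] by (simp add: Z_def)
    moreover have "AE x in \<nu>. x \<in> space \<nu>" by simp
    ultimately have "AE x in \<nu>. False"
      by eventually_elim (use h_pos in fastforce)
    with space_not_null show False ..
  qed
  moreover have "0 \<le> Z \<theta>"
    unfolding Z_def by (rule integral_nonneg_AE[OF nn])
  ultimately show ?thesis by simp
qed

section \<open>Normalized densities and the mean-value map\<close>

lemma natural_density_eq: "\<theta> \<in> \<Gamma> \<Longrightarrow> natural_density \<nu> \<phi> h \<theta> = (\<lambda>x. exp (\<theta> \<bullet> \<phi> x) * h x / Z \<theta>)"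
  using Z_pos[of \<theta>] by (simp add: fun_eq_iff natural_density_def log_partition_def exp_diff flip: Z_def)

lemma natural_density_pos: "\<theta> \<in> \<Gamma> \<Longrightarrow> x \<in> space \<nu> \<Longrightarrow> 0 < natural_density \<nu> \<phi> h \<theta> x"
  using h_pos by (simp add: natural_density_def)

lemma natural_density_measurable [measurable]: "natural_density \<nu> \<phi> h \<theta> \<in> borel_measurable \<nu>"
  unfolding natural_density_def by measurable

lemma integrable_natural_density: "\<theta> \<in> \<Gamma> \<Longrightarrow> integrable \<nu> (natural_density \<nu> \<phi> h \<theta>)"
  by (simp add: natural_density_eq integrable_exp)

lemma integral_natural_density: "\<theta> \<in> \<Gamma> \<Longrightarrow> integral\<^sup>L \<nu> (natural_density \<nu> \<phi> h \<theta>) = 1"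
  using Z_pos[of \<theta>] by (simp add: natural_density_eq Z_def[symmetric])

lemma nn_integral_natural_density: "\<theta> \<in> \<Gamma> \<Longrightarrow> (\<integral>\<^sup>+x. ennreal (natural_density \<nu> \<phi> h \<theta> x) \<partial>\<nu>) = 1"
  using natural_density_pos
  by (subst nn_integral_eq_integral)
     (auto intro!: AE_I2 less_imp_le simp: integrable_natural_density integral_natural_density)

lemma prob_space_natural_density:
  "\<theta> \<in> \<Gamma> \<Longrightarrow> prob_space (density \<nu> (\<lambda>x. ennreal (natural_density \<nu> \<phi> h \<theta> x)))"
  by (intro prob_spaceI) (simp add: emeasure_density nn_integral_natural_density cong: nn_integral_cong)

text \<open>Dividing out a strictly positive probability density recovers \<open>\<nu>\<close> as a
  measure with finite density relative to a probability measure.\<close>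

lemma sigma_finite_\<nu>:
  assumes "\<theta> \<in> \<Gamma>"
  shows "sigma_finite_measure \<nu>"
proof -
  let ?q = "natural_density \<nu> \<phi> h \<theta>"
  interpret prob_space "density \<nu> (\<lambda>x. ennreal (?q x))"
    by (rule prob_space_natural_density[OF assms])
  have "density (density \<nu> (\<lambda>x. ennreal (?q x))) (\<lambda>x. ennreal (1 / ?q x))
      = density \<nu> (\<lambda>x. ennreal (?q x) * ennreal (1 / ?q x))"
    by (rule density_density_eq) measurable
  also have "\<dots> = density \<nu> (\<lambda>x. 1)"
    using natural_density_pos[OF assms]
    by (intro density_cong) (auto intro!: AE_I2 simp: ennreal_mult[symmetric] less_imp_le less_imp_neq[THEN not_sym])
  also have "\<dots> = \<nu>" by (rule density_1)
  finally have "density (density \<nu> (\<lambda>x. ennreal (?q x))) (\<lambda>x. ennreal (1 / ?q x)) = \<nu>" .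
  moreover have "sigma_finite_measure (density (density \<nu> (\<lambda>x. ennreal (?q x))) (\<lambda>x. ennreal (1 / ?q x)))"
    by (subst sigma_finite_iff_density_finite) auto
  ultimately show ?thesis by simp
qed

lemma mean_value_eq: "\<theta> \<in> \<Gamma> \<Longrightarrow> mean_value \<nu> \<phi> h \<theta> = unnormalized_mean \<theta> /\<^sub>R Z \<theta>"
  unfolding mean_value_def unnormalized_mean_def
  by (subst integral_scaleR_right[symmetric])
     (simp_all add: natural_density_eq divide_inverse mult_ac integrable_exp_\<phi>)

lemma continuous_on_mean_value: "continuous_on \<Gamma> (mean_value \<nu> \<phi> h)"
proof -
  have "continuous_on \<Gamma> (\<lambda>\<theta>. unnormalized_mean \<theta> /\<^sub>R Z \<theta>)"
    using Z_pos by (intro continuous_intros continuous_on_Z continuous_on_unnormalized_mean) force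
  then show ?thesis
    by (simp add: mean_value_eq cong: continuous_on_cong)
qed

lemma integrable_natural_density_\<phi>:
  assumes "\<theta> \<in> \<Gamma>"
  shows "integrable \<nu> (\<lambda>x. natural_density \<nu> \<phi> h \<theta> x *\<^sub>R \<phi> x)"
proof -
  have "integrable \<nu> (\<lambda>x. inverse (Z \<theta>) *\<^sub>R ((exp (\<theta> \<bullet> \<phi> x) * h x) *\<^sub>R \<phi> x))"
    by (rule integrable_scaleR_right[OF integrable_exp_\<phi>[OF assms]])
  then show ?thesis
    using assms by (simp add: natural_density_eq divide_inverse mult_ac)
qed

text \<open>
  If \<open>\<theta>\<close> and \<open>\<theta>'\<close> have the same mean, the symmetrized Kullback-Leibler divergence
  \<open>\<integral> (p - p') (ln p - ln p')\<close> vanishes, since \<open>ln p - ln p'\<close> is affine in \<open>\<phi>\<close>. Its integrand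
  is nonnegative, so \<open>\<phi>\<close> would satisfy an affine relation.
\<close>

lemma inj_on_mean_value: "inj_on (mean_value \<nu> \<phi> h) \<Gamma>"
proof (rule inj_onI)
  fix \<theta> \<theta>' assume \<theta>: "\<theta> \<in> \<Gamma>" "\<theta>' \<in> \<Gamma>" and eq: "mean_value \<nu> \<phi> h \<theta> = mean_value \<nu> \<phi> h \<theta>'"
  let ?p = "natural_density \<nu> \<phi> h"
  let ?c = "log_partition \<nu> \<phi> h \<theta> - log_partition \<nu> \<phi> h \<theta>'"
  let ?s = "\<lambda>\<theta> x. \<theta> \<bullet> \<phi> x - log_partition \<nu> \<phi> h \<theta>"
  define f where "f x = (?p \<theta> x - ?p \<theta>' x) * ((\<theta> - \<theta>') \<bullet> \<phi> x - ?c)" for x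
  \<comment> \<open>This form is linear in integrable functions and yields the value of the
    integral; the form \<open>f2\<close> below shows the sign, by monotonicity of
    \<open>exp\<close>.\<close>
  have f1: "f x = (\<theta> - \<theta>') \<bullet> (?p \<theta> x *\<^sub>R \<phi> x - ?p \<theta>' x *\<^sub>R \<phi> x) - ?c * (?p \<theta> x - ?p \<theta>' x)" for x
    by (simp add: f_def inner_diff_right inner_diff_left algebra_simps)
  have f2: "f x = (exp (?s \<theta> x) - exp (?s \<theta>' x)) * (?s \<theta> x - ?s \<theta>' x) * h x" for x
    by (simp add: f_def natural_density_def inner_diff_left algebra_simps)
  have monotone: "0 \<le> (exp s - exp t) * (s - t)" for s t :: real
    by (cases "s \<le> t") (auto intro: mult_nonpos_nonpos)
  have int: "integrable \<nu> f"
    unfolding f1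
    by (intro Bochner_Integration.integrable_diff integrable_inner_right integrable_mult_right
        integrable_natural_density integrable_natural_density_\<phi> \<theta>)
  have "integral\<^sup>L \<nu> f = (\<theta> - \<theta>') \<bullet> (mean_value \<nu> \<phi> h \<theta> - mean_value \<nu> \<phi> h \<theta>') - ?c * (1 - 1)"
    unfolding f1 mean_value_def
    using \<theta> by (simp add: integrable_natural_density integrable_natural_density_\<phi> integral_natural_density)
  then have "integral\<^sup>L \<nu> f = 0"
    using eq by simp
  moreover have "AE x in \<nu>. 0 \<le> f x"
    unfolding f2 using h_pos by (intro AE_I2 mult_nonneg_nonneg monotone) (auto intro: less_imp_le)
  ultimately have "AE x in \<nu>. f x = 0"
    using integral_nonneg_eq_0_iff_AE[OF int] by simp
  moreover have "AE x in \<nu>. x \<in> space \<nu>" by simp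
  ultimately have "AE x in \<nu>. (\<theta> - \<theta>') \<bullet> \<phi> x = ?c"
  proof eventually_elim
    case (elim x)
    then have "?s \<theta> x = ?s \<theta>' x"
      using h_pos[of x] unfolding f2 by auto
    then show ?case by (simp add: inner_diff_left)
  qed
  from minimal[OF this] show "\<theta> = \<theta>'" by simp
qed

section \<open>The inverse of the mean-value map and joint measurability\<close>

abbreviation M where "M \<equiv> mean_space \<nu> \<phi> h \<Gamma>"

abbreviation natural_parameter where "natural_parameter \<equiv> inv_into \<Gamma> (mean_value \<nu> \<phi> h)"

lemma natural_parameter_in: "\<mu> \<in> M \<Longrightarrow> natural_parameter \<mu> \<in> \<Gamma>"
  by (simp add: mean_space_def inv_into_into)

text \<open>Invariance of domain applies because parameters and means live in the same space
  \<open>real^'m\<close>. Openness makes \<open>M\<close> a Borel set.\<close>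

lemma open_mean_space: "open M"
  unfolding mean_space_def
  by (rule invariance_of_domain[OF continuous_on_mean_value open_\<Gamma> inj_on_mean_value])

lemma continuous_on_natural_parameter: "continuous_on M natural_parameter"
  unfolding mean_space_def
  using continuous_on_inverse_open[OF open_\<Gamma> continuous_on_mean_value] inj_on_mean_value by simp

text \<open>Outside \<open>M\<close> the value of \<open>inv_into\<close> is arbitrary, so only the
  density cut off by the indicator is treated. Its ingredients are continuous on \<open>M\<close>,
  and extending them by 0 keeps them Borel.\<close>

lemma mean_density_jointly_measurable:
  "(\<lambda>(\<mu>, x). indicator M \<mu> * mean_density \<nu> \<phi> h \<Gamma> \<mu> x) \<in> borel_measurable (borel \<Otimes>\<^sub>M \<nu>)"
proof -
  have M: "M \<in> sets borel"
    using open_mean_space by simp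
  have "continuous_on M (\<lambda>\<mu>. Z (natural_parameter \<mu>))"
    using natural_parameter_in
    by (intro continuous_on_compose2[OF continuous_on_Z continuous_on_natural_parameter]) auto
  note [measurable] = M
    borel_measurable_continuous_on_indicator[OF M continuous_on_natural_parameter]
    borel_measurable_continuous_on_indicator[OF M this]
  have "(\<lambda>(\<mu>, x). indicator M \<mu> * (exp ((indicator M \<mu> *\<^sub>R natural_parameter \<mu>) \<bullet> \<phi> x) * h x
        / (indicator M \<mu> *\<^sub>R Z (natural_parameter \<mu>)))) \<in> borel_measurable (borel \<Otimes>\<^sub>M \<nu>)"
    by measurable
  also have "(\<lambda>(\<mu>, x). indicator M \<mu> * (exp ((indicator M \<mu> *\<^sub>R natural_parameter \<mu>) \<bullet> \<phi> x) * h x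
        / (indicator M \<mu> *\<^sub>R Z (natural_parameter \<mu>))))
      = (\<lambda>(\<mu>, x). indicator M \<mu> * mean_density \<nu> \<phi> h \<Gamma> \<mu> x)"
    by (auto simp: fun_eq_iff mean_density_def indicator_def natural_density_eq natural_parameter_in)
  finally show ?thesis .
qed

end

section \<open>Bayes marginals over the mean-value parameter\<close>

context exp_family
begin

abbreviation q where "q \<equiv> mean_density \<nu> \<phi> h \<Gamma>"

lemma mean_density_pos: "\<mu> \<in> M \<Longrightarrow> x \<in> space \<nu> \<Longrightarrow> 0 < q \<mu> x"
  unfolding mean_density_def by (intro natural_density_pos natural_parameter_in)

lemma mean_density_measurable [measurable]: "q \<mu> \<in> borel_measurable \<nu>"
  unfolding mean_density_def by measurable

lemma nn_integral_mean_density: "\<mu> \<in> M \<Longrightarrow> (\<integral>\<^sup>+x. ennreal (q \<mu> x) \<partial>\<nu>) = 1"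
  unfolding mean_density_def by (intro nn_integral_natural_density natural_parameter_in)

text \<open>With the indicator in every factor, each factor becomes measurable on the whole
  parameter space.\<close>

lemma bayes_marginal_eq:
  "bayes_marginal M \<omega> q xs
    = (\<integral>\<^sup>+\<mu>. ennreal (indicator M \<mu> * \<omega> \<mu> * prod_list (map (\<lambda>x. indicator M \<mu> * q \<mu> x) xs)) \<partial>lborel)"
  unfolding bayes_marginal_def likelihood_def
  by (intro nn_integral_cong) (auto simp: indicator_def)

lemma prior_measurable:
  assumes "prior_density M \<omega>"
  shows "(\<lambda>\<mu>. indicator M \<mu> * \<omega> \<mu>) \<in> borel_measurable borel"
  using borel_measurable_continuous_on_indicator[of M \<omega>] open_mean_space assms
  by (simp add: prior_density_def)

text \<open>The integrand is jointly measurable in the sequence and the parameter, so integrating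
  out the parameter preserves measurability.\<close>

lemma prefix_measurable_bayes_marginal:
  assumes \<omega>: "prior_density M \<omega>"
  shows "prefix_measurable \<nu> (bayes_marginal M \<omega> q)"
  unfolding prefix_measurable_def
proof
  fix n
  let ?S = "\<Pi>\<^sub>M i\<in>(UNIV::nat set). \<nu>"
  note [measurable] = prior_measurable[OF \<omega>]
  have "(\<lambda>(\<omega>, \<mu>). indicator M \<mu> * q \<mu> (\<omega> i)) \<in> borel_measurable (?S \<Otimes>\<^sub>M lborel)" for i
    using measurable_compose[OF _ mean_density_jointly_measurable, of "\<lambda>(\<omega>, \<mu>). (\<mu>, \<omega> i)" "?S \<Otimes>\<^sub>M lborel"]
    by (simp add: split_beta')
  then have [measurable]: "(\<lambda>x. indicator M (snd x) * q (snd x) (fst x i)) \<in> borel_measurable (?S \<Otimes>\<^sub>M lborel)" for i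
    by (simp add: split_beta')
  have prod: "prod_list (map (f \<circ> x) [0..<n]) = (\<Prod>i<n. f (x i))" for f :: "real^'d \<Rightarrow> real" and x
    by (induction n) simp_all
  show "(\<lambda>x. bayes_marginal M \<omega> q (map x [0..<n])) \<in> borel_measurable ?S"
    unfolding bayes_marginal_eq map_map prod
    by (intro lborel.borel_measurable_nn_integral) (simp add: split_beta')
qed

text \<open>By Tonelli the new observation is integrated out first, and each density of the family
  has integral 1.\<close>

lemma nn_integral_bayes_marginal_snoc:
  assumes \<omega>: "prior_density M \<omega>" and \<mu>0: "\<mu>0 \<in> M" and xs: "xs \<in> lists (space \<nu>)"
  shows "(\<integral>\<^sup>+x. bayes_marginal M \<omega> q (xs @ [x]) \<partial>\<nu>) = bayes_marginal M \<omega> q xs"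
proof -
  \<comment> \<open>The density at \<open>\<mu>0\<close> witnesses that \<open>\<nu>\<close> is
    sigma-finite, which Tonelli requires.\<close>
  interpret \<nu>: sigma_finite_measure \<nu>
    using sigma_finite_\<nu>[OF natural_parameter_in[OF \<mu>0]] .
  interpret pair_sigma_finite lborel \<nu> ..
  let ?w = "\<lambda>\<mu>. indicator M \<mu> * \<omega> \<mu> * likelihood (\<lambda>x. indicator M \<mu> * q \<mu> x) xs"
  note [measurable] = prior_measurable[OF \<omega>] mean_density_jointly_measurable
  have eq: "bayes_marginal M \<omega> q ys
      = (\<integral>\<^sup>+\<mu>. ennreal (indicator M \<mu> * \<omega> \<mu> * likelihood (\<lambda>x. indicator M \<mu> * q \<mu> x) ys) \<partial>lborel)" for ys
    unfolding bayes_marginal_eq likelihood_def ..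
  have single: "(\<lambda>\<mu>. indicator M \<mu> * q \<mu> x) \<in> borel_measurable borel" if "x \<in> space \<nu>" for x
    using measurable_compose[OF _ mean_density_jointly_measurable, of "\<lambda>\<mu>. (\<mu>, x)" borel] that by simp
  have [measurable]: "(\<lambda>\<mu>. likelihood (\<lambda>x. indicator M \<mu> * q \<mu> x) xs) \<in> borel_measurable borel"
    using xs
  proof (induction xs)
    case (Cons x xs)
    then show ?case
      using single[of x] by (auto simp: likelihood_def intro!: borel_measurable_times)
  qed (simp add: likelihood_def)
  have w_nonneg: "0 \<le> ?w \<mu>" for \<mu>
    using \<omega> mean_density_pos[of \<mu>] xs
    by (cases "\<mu> \<in> M") (auto simp: prior_density_def intro!: mult_nonneg_nonneg likelihood_nonneg intro: less_imp_le)
  have "(\<integral>\<^sup>+x. bayes_marginal M \<omega> q (xs @ [x]) \<partial>\<nu>)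
      = (\<integral>\<^sup>+x. \<integral>\<^sup>+\<mu>. ennreal (?w \<mu> * (indicator M \<mu> * q \<mu> x)) \<partial>lborel \<partial>\<nu>)"
    unfolding eq by (simp add: mult.assoc)
  also have "\<dots> = (\<integral>\<^sup>+\<mu>. \<integral>\<^sup>+x. ennreal (?w \<mu> * (indicator M \<mu> * q \<mu> x)) \<partial>\<nu> \<partial>lborel)"
    by (rule Fubini') measurable
  also have "\<dots> = (\<integral>\<^sup>+\<mu>. ennreal (?w \<mu>) \<partial>lborel)"
  proof (rule nn_integral_cong)
    fix \<mu>
    show "(\<integral>\<^sup>+x. ennreal (?w \<mu> * (indicator M \<mu> * q \<mu> x)) \<partial>\<nu>) = ennreal (?w \<mu>)"
    proof (cases "\<mu> \<in> M")
      case True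
      have "(\<integral>\<^sup>+x. ennreal (?w \<mu> * (indicator M \<mu> * q \<mu> x)) \<partial>\<nu>) = (\<integral>\<^sup>+x. ennreal (?w \<mu>) * ennreal (q \<mu> x) \<partial>\<nu>)"
        using True w_nonneg[of \<mu>] mean_density_pos[OF True]
        by (intro nn_integral_cong) (simp add: ennreal_mult')
      also have "\<dots> = ennreal (?w \<mu>) * (\<integral>\<^sup>+x. ennreal (q \<mu> x) \<partial>\<nu>)"
        by (rule nn_integral_cmult) measurable
      finally show ?thesis
        using nn_integral_mean_density[OF True] by simp
    qed simp
  qed
  finally show ?thesis
    unfolding eq .
qed

lemma bayes_marginal_Nil: "prior_density M \<omega> \<Longrightarrow> bayes_marginal M \<omega> q [] = 1"
  by (simp add: bayes_marginal_def prior_density_def)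

lemma switch_from_simple_null_bayes:
  assumes "prior_density M \<omega>" "\<mu>0 \<in> M"
  shows "switch_from_simple_null \<nu> (q \<mu>0) (bayes_marginal M \<omega> q)"
proof (rule switch_from_simple_null.intro)
  show "prob_space (density \<nu> (\<lambda>x. ennreal (q \<mu>0 x)))"
    unfolding mean_density_def using assms(2) by (intro prob_space_natural_density natural_parameter_in)
qed (use assms in \<open>auto simp: mean_density_pos prefix_measurable_bayes_marginal
    nn_integral_bayes_marginal_snoc bayes_marginal_Nil\<close>)

end

lemma infinite_set_pmf_switch_prior: "switch_prior \<kappa> \<pi> \<Longrightarrow> infinite (set_pmf \<pi>)"
  unfolding switch_prior_def by (auto intro!: range_inj_infinite injI)

theorem mainTheorem2:
  fixes \<X> :: "(real^'d) set" and \<nu> :: "(real^'d) measure"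
    and \<phi> :: "real^'d \<Rightarrow> real^'m" and h :: "real^'d \<Rightarrow> real"
    and \<Gamma> M\<^sub>1 :: "(real^'m) set" and p :: "real^'m \<Rightarrow> real^'d \<Rightarrow> real"
    and \<mu>\<^sub>0 :: "real^'m" and \<omega>\<^sub>1 :: "real^'m \<Rightarrow> real"
    and \<pi> :: "nat pmf" and \<kappa> :: real
    and p\<^sub>B\<^sub>0 p\<^sub>B\<^sub>1 :: "(real^'d) list \<Rightarrow> ennreal"
  assumes "exponential_family \<X> \<nu> \<phi> h \<Gamma>"
    and "M\<^sub>1 = mean_space \<nu> \<phi> h \<Gamma>"
    and "product_of_open_intervals M\<^sub>1"
    and "p = mean_density \<nu> \<phi> h \<Gamma>"
    and "\<mu>\<^sub>0 \<in> M\<^sub>1"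
    and "prior_density M\<^sub>1 \<omega>\<^sub>1"
    and "\<kappa> > 1" and "switch_prior \<kappa> \<pi>"
    and "p\<^sub>B\<^sub>0 = (\<lambda>xs. ennreal (likelihood (p \<mu>\<^sub>0) xs))"
    and "p\<^sub>B\<^sub>1 = bayes_marginal M\<^sub>1 \<omega>\<^sub>1 p"
  shows "robust_null_test {\<mu>\<^sub>0} (\<lambda>\<mu>. iid_measure \<nu> (p \<mu>)) (switch_ratio \<pi> p\<^sub>B\<^sub>0 p\<^sub>B\<^sub>1) (\<lambda>\<alpha>. \<alpha>)"
proof -
  interpret exp_family \<X> \<nu> \<phi> h \<Gamma>
    by standard fact
  have "switch_from_simple_null \<nu> (p \<mu>\<^sub>0) p\<^sub>B\<^sub>1"
    using switch_from_simple_null_bayes assms by simp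
  then show ?thesis
    unfolding assms(9)
    by (rule switch_from_simple_null.robust_null_test_switch_ratio)
       (use assms infinite_set_pmf_switch_prior in auto)
qed

end
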